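(* Let $m\in(0,\infty)$, let $\{W_x : x\in\mathbb{N}_{\ge 1}\}$ be an independent family of exponential random variables with common mean $m$, and let $$Nf=\sum_{x\ge 1}\frac{W_x}{x^2}.$$ Then the mean, variance and second moment of $Nf$ are $$\mathbb{E}\,Nf=m\,\zeta(2)=\frac{m\pi^2}{6},\qquad \operatorname{Var}(Nf)=m^2\zeta(4)=\frac{m^2\pi^4}{90},\qquad \mathbb{E}(Nf)^2=\frac{7m^2\pi^4}{180},$$ so that the signal-to-noise ratio is constant, $\mathbb{E}Nf/\sqrt{\operatorname{Var}(Nf)}=\sqrt{5/2}$. Moreover, the skewness of $Nf$ is $$\operatorname{Skewness}(Nf)=\frac{4\sqrt{10}}{7}$$ and the kurtosis of $Nf$ is $$\operatorname{Kurtosis}(Nf)=\frac{57}{7}.$$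
   Context: $\zeta$ is the Riemann zeta function and $\mathbb{N}_{\ge1}=\{1,2,3,\dots\}$. An exponential random variable with mean $m$ has density $m^{-1}e^{-z/m}$ on $z>0$. For a random variable $Y$ with mean $\mu$ and standard deviation $\sigma>0$, the skewness is $\mathbb{E}(Y-\mu)^3/\sigma^3$ and the kurtosis is the (non-excess) standardized fourth moment $\mathbb{E}(Y-\mu)^4/\sigma^4$. *)

theory Defs
  imports "HOL-Probability.Probability"
begin

text \<open>The Riemann zeta function on the half-line \<open>s > 1\<close>, where it is given by its Dirichlet
  series.  For \<open>s \<le> 1\<close> the series diverges and the value below is meaningless (it is not the
  analytic continuation).\<close>

definition riemann_zeta :: "real \<Rightarrow> real" where
  "riemann_zeta s = (\<Sum>n. 1 / real (Suc n) powr s)"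

definition std_dev :: "'a measure \<Rightarrow> ('a \<Rightarrow> real) \<Rightarrow> real" where
  "std_dev M Y = sqrt (prob_space.variance M Y)"

definition skewness :: "'a measure \<Rightarrow> ('a \<Rightarrow> real) \<Rightarrow> real" where
  "skewness M Y =
     prob_space.expectation M (\<lambda>\<omega>. (Y \<omega> - prob_space.expectation M Y) ^ 3) / std_dev M Y ^ 3"

text \<open>Non-excess kurtosis: a normal distribution has kurtosis 3.\<close>

definition kurtosis :: "'a measure \<Rightarrow> ('a \<Rightarrow> real) \<Rightarrow> real" where
  "kurtosis M Y =
     prob_space.expectation M (\<lambda>\<omega>. (Y \<omega> - prob_space.expectation M Y) ^ 4) / std_dev M Y ^ 4"

text \<open>The sum over \<open>x \<ge> 1\<close>, written with \<open>x = Suc n\<close>; the value \<open>W 0\<close> is never used.\<close>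

definition Nf :: "(nat \<Rightarrow> 'a \<Rightarrow> real) \<Rightarrow> 'a \<Rightarrow> real" where
  "Nf W \<omega> = (\<Sum>n. W (Suc n) \<omega> / real (Suc n) ^ 2)"

end

theory Submission
  imports Defs
begin

text \<open>
  The centred partial sums of the series are sums of independent centred variables, so their
  moments up to order four are explicit combinations of the partial sums of \<open>\<zeta>(4)\<close>, \<open>\<zeta>(6)\<close> and
  \<open>\<zeta>(8)\<close>.  Since the terms of the series are nonnegative, monotone convergence of the fourth
  moments makes the limit \<open>L\<^sup>4\<close>-integrable, which in turn provides the dominating function for
  passing to the limit in the central moments.

  The zeta values come from differentiating \<open>\<psi>(x) - \<psi>(1 - x) = - \<pi> cot (\<pi> x)\<close>: for odd \<open>n\<close>
  and \<open>x = 1/2\<close> the left-hand side becomes \<open>2 \<psi>\<^sup>(\<^sup>n\<^sup>) (1/2)\<close>, which is a multiple of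
  \<open>\<Sum>k. 1 / (k + 1/2) ^ (n + 1)\<close>, while the derivatives of the cotangent are polynomials in the
  cotangent, which vanishes there.
\<close>

section \<open>Zeta values at even integers from the cotangent\<close>

lemma Gamma_reflection_real: "Gamma x * Gamma (1 - x) = pi / sin (pi * x)" for x :: real
proof -
  have "complex_of_real (Gamma x * Gamma (1 - x)) = complex_of_real (pi / sin (pi * x))"
    using Gamma_reflection_complex[of "of_real x"]
    by (simp add: Gamma_complex_of_real [symmetric] sin_of_real [symmetric])
  thus ?thesis by (simp only: of_real_eq_iff)
qed

text \<open>The \<open>n\<close>-th derivative of the cotangent is \<open>cot_poly n\<close> evaluated at the cotangent,
  because \<open>cot' = - (1 + cot\<^sup>2)\<close>.\<close>

fun cot_poly :: "nat \<Rightarrow> real poly" where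
  "cot_poly 0 = [:0, 1:]"
| "cot_poly (Suc n) = - ([:1, 0, 1:] * pderiv (cot_poly n))"

text \<open>Differentiating \<open>n\<close> times produces one factor \<open>- 1\<close> per
  derivative from the inner function \<open>1 - x\<close> and one factor \<open>pi\<close> from
  \<open>pi * x\<close>. The base case is the logarithmic derivative of the reflection formula for
  \<open>Gamma\<close>.\<close>

lemma Polygamma_reflection:
  fixes x :: real
  assumes "0 < x" "x < 1"
  shows "Polygamma n x - (-1) ^ n * Polygamma n (1 - x) = - (pi ^ Suc n * poly (cot_poly n) (cot (pi * x)))"
  using assms
proof (induction n arbitrary: x)
  case 0
  have nonpos: "y \<notin> \<int>\<^sub>\<le>\<^sub>0" if "y > 0" for y :: real
    using that by (auto elim!: nonpos_Ints_cases)
  have s: "sin (pi * y) > 0" if "0 < y" "y < 1" for y :: real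
    using that by (intro sin_gt_zero) auto
  \<comment> \<open>With the sine moved to the left, the reflection formula says that
    \<open>g\<close> equals \<open>pi\<close> throughout the unit interval. Its derivative from the
    product rule must therefore vanish, and the positive \<open>Gamma\<close> factors
    cancel.\<close>
  define g where "g = (\<lambda>y::real. Gamma y * Gamma (1 - y) * sin (pi * y))"
  have g: "g y = pi" if "0 < y" "y < 1" for y
    using s[OF that] unfolding g_def by (subst Gamma_reflection_real) simp
  have "(g has_field_derivative
      Gamma x * Gamma (1 - x) * ((Digamma x - Digamma (1 - x)) * sin (pi * x) + pi * cos (pi * x))) (at x)"
    unfolding g_def using nonpos[of x] nonpos[of "1 - x"] 0
    by (auto intro!: derivative_eq_intros simp: algebra_simps)
  moreover have "(g has_field_derivative 0) (at x)"
    by (rule has_field_derivative_transform_within_open[of "\<lambda>_. pi" _ _ "{0<..<1}"])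
       (use 0 g in auto)
  ultimately have "Gamma x * Gamma (1 - x) * ((Digamma x - Digamma (1 - x)) * sin (pi * x) + pi * cos (pi * x)) = 0"
    by (rule DERIV_unique)
  moreover have "Gamma x > 0" "Gamma (1 - x) > 0" using 0 by auto
  ultimately have "(Digamma x - Digamma (1 - x)) * sin (pi * x) + pi * cos (pi * x) = 0"
    by simp
  then show ?case using s[OF 0] by (simp add: cot_def field_simps)
next
  case (Suc n)
  have nonpos: "y \<notin> \<int>\<^sub>\<le>\<^sub>0" if "y > 0" for y :: real
    using that by (auto elim!: nonpos_Ints_cases)
  have s: "sin (pi * x) > 0"
    using Suc.prems by (intro sin_gt_zero) auto
  \<comment> \<open>By the induction hypothesis \<open>g\<close> agrees with the cotangent
    expression on the whole open interval, so both sides may be differentiated; \<open>A\<close> and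
    \<open>B\<close> are the two resulting derivatives.\<close>
  define g where "g = (\<lambda>y::real. Polygamma n y - (-1) ^ n * Polygamma n (1 - y))"
  have A: "(g has_field_derivative Polygamma (Suc n) x - (-1) ^ Suc n * Polygamma (Suc n) (1 - x)) (at x)"
    unfolding g_def using nonpos[of x] nonpos[of "1 - x"] Suc.prems
    by (auto intro!: derivative_eq_intros)
  have pyth: "- (sin (pi * x) * pi * sin (pi * x)) - cos (pi * x) * (cos (pi * x) * pi) = - pi"
    using sin_cos_squared_add[of "pi * x"] by algebra
  have "((\<lambda>y. cot (pi * y)) has_field_derivative - pi / sin (pi * x) ^ 2) (at x)"
    using s unfolding cot_def
    by (auto intro!: derivative_eq_intros simp: pyth power2_eq_square)
  moreover have cot_sq: "1 / sin (pi * x) ^ 2 = 1 + cot (pi * x) ^ 2"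
    using s sin_cos_squared_add[of "pi * x"] by (simp add: cot_def divide_simps)
  have "- pi / sin (pi * x) ^ 2 = - pi * (1 + cot (pi * x) ^ 2)"
    unfolding cot_sq [symmetric] by simp
  ultimately have "((\<lambda>y. cot (pi * y)) has_field_derivative - pi * (1 + cot (pi * x) ^ 2)) (at x)"
    by simp
  then have "((\<lambda>y. - (pi ^ Suc n * poly (cot_poly n) (cot (pi * y)))) has_field_derivative
      - (pi ^ Suc n * (poly (pderiv (cot_poly n)) (cot (pi * x)) * (- pi * (1 + cot (pi * x) ^ 2))))) (at x)"
    by (intro DERIV_minus DERIV_cmult DERIV_chain2[OF poly_DERIV])
  then have B: "(g has_field_derivative
      - (pi ^ Suc n * (poly (pderiv (cot_poly n)) (cot (pi * x)) * (- pi * (1 + cot (pi * x) ^ 2))))) (at x)"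
    by (rule has_field_derivative_transform_within_open[of _ _ _ "{0<..<1}"])
       (use Suc g_def in auto)
  show ?case
    using DERIV_unique[OF A B] by (simp add: power2_eq_square algebra_simps)
qed

text \<open>At \<open>x = 1/2\<close> the two Polygamma terms of the reflection formula coincide,
  and for odd \<open>n\<close> they add instead of cancelling. This evaluates the sum over
  half-integers, which determines the sum over integers by a parity split.\<close>

lemma sums_inverse_even_powers:
  assumes "n > 0" "odd n"
  shows "(\<lambda>k. 1 / real (Suc k) ^ Suc n) sums
    (- (pi ^ Suc n * poly (cot_poly n) 0) / (2 * fact n * (2 ^ Suc n - 1)))"
proof -
  \<comment> \<open>The series for Polygamma carries the sign \<open>(-1) ^ Suc n\<close>, which is
    1 for odd \<open>n\<close>.\<close>
  define H where "H = Polygamma n (1 / 2 :: real) / fact n"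
  define Z where "Z = Polygamma n (1 :: real) / fact n"
  have H: "(\<lambda>k. inverse ((1 / 2 + real k) ^ Suc n)) sums H"
    using Polygamma_LIMSEQ[of "1/2::real" n] assms by (simp add: H_def)
  have Z: "(\<lambda>k. inverse ((1 + real k) ^ Suc n)) sums Z"
    using Polygamma_LIMSEQ[of "1::real" n] assms by (simp add: Z_def)
  \<comment> \<open>Separating odd and even bases gives \<open>2 ^ Suc n * Z = H + Z\<close>.\<close>
  have "(\<lambda>k. \<Sum>i = k * 2..<k * 2 + 2. inverse ((1 + real i) ^ Suc n)) sums Z"
    by (rule sums_group[OF Z]) simp
  also have "(\<lambda>k. \<Sum>i = k * 2..<k * 2 + 2. inverse ((1 + real i) ^ Suc n)) =
    (\<lambda>k. (inverse ((1 / 2 + real k) ^ Suc n) + inverse ((1 + real k) ^ Suc n)) / 2 ^ Suc n)"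
  proof
    fix k :: nat
    have "{k * 2..<k * 2 + 2} = {2 * k, 2 * k + 1}" by auto
    then have "(\<Sum>i = k * 2..<k * 2 + 2. inverse ((1 + real i) ^ Suc n)) =
      inverse ((2 * (1 / 2 + real k)) ^ Suc n) + inverse ((2 * (1 + real k)) ^ Suc n)"
      by (simp add: algebra_simps del: power_Suc)
    then show "(\<Sum>i = k * 2..<k * 2 + 2. inverse ((1 + real i) ^ Suc n)) =
       (inverse ((1 / 2 + real k) ^ Suc n) + inverse ((1 + real k) ^ Suc n)) / 2 ^ Suc n"
      unfolding power_mult_distrib by (simp add: field_simps del: power_Suc)
  qed
  finally have "Z = (H + Z) / 2 ^ Suc n"
    using sums_divide[OF sums_add[OF H Z], of "2 ^ Suc n"] sums_unique2 by blast
  then have "Z * (2 ^ Suc n - 1) = H"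
    by (simp add: field_simps del: power_Suc)
  moreover have "(2::real) ^ Suc n - 1 \<noteq> 0"
    using one_less_power[of "2::real" "Suc n"] by simp
  ultimately have "Z = H / (2 ^ Suc n - 1)"
    by (rule eq_divide_imp [rotated])
  moreover have "Polygamma n (1/2 :: real) = - (pi ^ Suc n * poly (cot_poly n) 0) / 2"
    using Polygamma_reflection[of "1/2" n] assms by (simp add: cot_def)
  ultimately have "Z = - (pi ^ Suc n * poly (cot_poly n) 0) / (2 * fact n * (2 ^ Suc n - 1))"
    by (simp add: H_def mult.assoc del: power_Suc)
  then show ?thesis using Z by (simp add: inverse_eq_divide add.commute)
qed

text \<open>The constant terms of \<open>cot_poly\<close> at 3, 5 and 7 are -2, -16 and -272, the
  negated tangent numbers.\<close>

lemma sums_inverse_powers: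
  "(\<lambda>k. 1 / real (Suc k) ^ 4) sums (pi ^ 4 / 90)"
  "(\<lambda>k. 1 / real (Suc k) ^ 6) sums (pi ^ 6 / 945)"
  "(\<lambda>k. 1 / real (Suc k) ^ 8) sums (pi ^ 8 / 9450)"
  using sums_inverse_even_powers[of 3, OF zero_less_numeral odd_numeral]
    sums_inverse_even_powers[of 5, OF zero_less_numeral odd_numeral]
    sums_inverse_even_powers[of 7, OF zero_less_numeral odd_numeral]
  by (simp_all add: eval_nat_numeral pderiv_pCons fact_reduce)

lemma riemann_zeta_sums:
  assumes "(\<lambda>k. 1 / real (Suc k) ^ s) sums z"
  shows "riemann_zeta (real s) = z"
  using assms by (simp add: riemann_zeta_def powr_realpow sums_iff)

section \<open>Moments up to order four of independent sums\<close>

lemma abs_power_le_one_plus_power4: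
  fixes x :: real
  assumes "k \<le> 4"
  shows "\<bar>x\<bar> ^ k \<le> 1 + x ^ 4"
proof (cases "\<bar>x\<bar> \<le> 1")
  case True
  then have "\<bar>x\<bar> ^ k \<le> 1" by (simp add: power_le_one)
  then show ?thesis by (simp add: add_increasing2)
next
  case False
  then have "\<bar>x\<bar> ^ k \<le> \<bar>x\<bar> ^ 4" using assms by (intro power_increasing) auto
  then show ?thesis by simp
qed

lemma (in prob_space) integrable_power_le_4:
  fixes X :: "'a \<Rightarrow> real"
  assumes [measurable]: "X \<in> borel_measurable M" and "integrable M (\<lambda>\<omega>. X \<omega> ^ 4)" "k \<le> 4"
  shows "integrable M (\<lambda>\<omega>. X \<omega> ^ k)"
proof (rule Bochner_Integration.integrable_bound)
  show "integrable M (\<lambda>\<omega>. 1 + X \<omega> ^ 4)" using assms by auto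
  show "AE \<omega> in M. norm (X \<omega> ^ k) \<le> norm (1 + X \<omega> ^ 4)"
    using abs_power_le_one_plus_power4[OF \<open>k \<le> 4\<close>] by (auto simp: power_abs)
qed simp

text \<open>In the binomial expansion independence factors every mixed moment, and each one
  containing a first moment vanishes. Up to order four the only surviving mixed term is the product
  of second moments, with coefficient \<open>4 choose 2\<close>.\<close>

lemma (in prob_space) expectation_power_add:
  fixes X Y :: "'a \<Rightarrow> real"
  assumes indep: "indep_var borel X borel Y"
    and X: "integrable M (\<lambda>\<omega>. X \<omega> ^ 4)" "expectation X = 0"
    and Y: "integrable M (\<lambda>\<omega>. Y \<omega> ^ 4)" "expectation Y = 0"
  shows "integrable M (\<lambda>\<omega>. (X \<omega> + Y \<omega>) ^ 4)"
    and "expectation (\<lambda>\<omega>. X \<omega> + Y \<omega>) = 0"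
    and "expectation (\<lambda>\<omega>. (X \<omega> + Y \<omega>) ^ 2) = expectation (\<lambda>\<omega>. X \<omega> ^ 2) + expectation (\<lambda>\<omega>. Y \<omega> ^ 2)"
    and "expectation (\<lambda>\<omega>. (X \<omega> + Y \<omega>) ^ 3) = expectation (\<lambda>\<omega>. X \<omega> ^ 3) + expectation (\<lambda>\<omega>. Y \<omega> ^ 3)"
    and "expectation (\<lambda>\<omega>. (X \<omega> + Y \<omega>) ^ 4) = expectation (\<lambda>\<omega>. X \<omega> ^ 4) + expectation (\<lambda>\<omega>. Y \<omega> ^ 4)
      + 6 * expectation (\<lambda>\<omega>. X \<omega> ^ 2) * expectation (\<lambda>\<omega>. Y \<omega> ^ 2)"
proof -
  have [measurable]: "X \<in> borel_measurable M" "Y \<in> borel_measurable M"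
    using indep by (auto dest: indep_var_rv1 indep_var_rv2)
  have intX: "integrable M (\<lambda>\<omega>. X \<omega> ^ k)" and intY: "integrable M (\<lambda>\<omega>. Y \<omega> ^ k)" if "k \<le> 4" for k
    using integrable_power_le_4[OF _ X(1) that] integrable_power_le_4[OF _ Y(1) that] by auto
  have ind: "indep_var borel (\<lambda>\<omega>. X \<omega> ^ j) borel (\<lambda>\<omega>. Y \<omega> ^ k)" for j k
    using indep_var_compose[OF indep, of "\<lambda>x. x ^ j" borel "\<lambda>x. x ^ k" borel] by (simp add: comp_def)
  have int: "integrable M (\<lambda>\<omega>. X \<omega> ^ j * Y \<omega> ^ k)" if "j \<le> 4" "k \<le> 4" for j k
    by (rule indep_var_integrable[OF ind intX[OF that(1)] intY[OF that(2)]])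
  have E: "expectation (\<lambda>\<omega>. X \<omega> ^ j * Y \<omega> ^ k) = expectation (\<lambda>\<omega>. X \<omega> ^ j) * expectation (\<lambda>\<omega>. Y \<omega> ^ k)"
    if "j \<le> 4" "k \<le> 4" for j k
    by (rule indep_var_lebesgue_integral[OF ind intX[OF that(1)] intY[OF that(2)]])
  have exp: "has_bochner_integral M (\<lambda>\<omega>. (X \<omega> + Y \<omega>) ^ n)
      (\<Sum>k\<le>n. of_nat (n choose k) * (expectation (\<lambda>\<omega>. X \<omega> ^ k) * expectation (\<lambda>\<omega>. Y \<omega> ^ (n - k))))"
    if "n \<le> 4" for n
    unfolding binomial_ring mult.assoc
    by (intro has_bochner_integral_sum has_bochner_integral_mult_right)
       (use that int E in \<open>auto simp: has_bochner_integral_iff\<close>)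
  show "integrable M (\<lambda>\<omega>. (X \<omega> + Y \<omega>) ^ 4)"
    using exp[of 4] by (simp add: has_bochner_integral_iff)
  show "expectation (\<lambda>\<omega>. X \<omega> + Y \<omega>) = 0"
    using exp[of 1] X Y by (simp add: has_bochner_integral_iff)
  show "expectation (\<lambda>\<omega>. (X \<omega> + Y \<omega>) ^ 2) = expectation (\<lambda>\<omega>. X \<omega> ^ 2) + expectation (\<lambda>\<omega>. Y \<omega> ^ 2)"
    using exp[of 2] X Y by (simp add: has_bochner_integral_iff numeral_2_eq_2 prob_space)
  show "expectation (\<lambda>\<omega>. (X \<omega> + Y \<omega>) ^ 3) = expectation (\<lambda>\<omega>. X \<omega> ^ 3) + expectation (\<lambda>\<omega>. Y \<omega> ^ 3)"
    using exp[of 3] X Y by (simp add: has_bochner_integral_iff numeral_3_eq_3 prob_space)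
  show "expectation (\<lambda>\<omega>. (X \<omega> + Y \<omega>) ^ 4) = expectation (\<lambda>\<omega>. X \<omega> ^ 4) + expectation (\<lambda>\<omega>. Y \<omega> ^ 4)
      + 6 * expectation (\<lambda>\<omega>. X \<omega> ^ 2) * expectation (\<lambda>\<omega>. Y \<omega> ^ 2)"
    using exp[of 4] X Y by (simp add: has_bochner_integral_iff eval_nat_numeral prob_space)
qed

text \<open>For centred variables the cumulants of orders two, three and four are the second moment,
  the third moment, and the fourth moment minus three times the squared second moment. All three are
  additive under independence, which explains the form of the last formula.\<close>

lemma (in prob_space) centered_sum_moments:
  fixes X :: "'i \<Rightarrow> 'a \<Rightarrow> real"
  assumes "finite I" "indep_vars (\<lambda>_. borel) X I"
    and "\<And>i. i \<in> I \<Longrightarrow> integrable M (\<lambda>\<omega>. X i \<omega> ^ 4)" "\<And>i. i \<in> I \<Longrightarrow> expectation (X i) = 0"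
  shows "integrable M (\<lambda>\<omega>. (\<Sum>i\<in>I. X i \<omega>) ^ 4)
    \<and> expectation (\<lambda>\<omega>. \<Sum>i\<in>I. X i \<omega>) = 0
    \<and> expectation (\<lambda>\<omega>. (\<Sum>i\<in>I. X i \<omega>) ^ 2) = (\<Sum>i\<in>I. expectation (\<lambda>\<omega>. X i \<omega> ^ 2))
    \<and> expectation (\<lambda>\<omega>. (\<Sum>i\<in>I. X i \<omega>) ^ 3) = (\<Sum>i\<in>I. expectation (\<lambda>\<omega>. X i \<omega> ^ 3))
    \<and> expectation (\<lambda>\<omega>. (\<Sum>i\<in>I. X i \<omega>) ^ 4) =
        (\<Sum>i\<in>I. expectation (\<lambda>\<omega>. X i \<omega> ^ 4) - 3 * expectation (\<lambda>\<omega>. X i \<omega> ^ 2) ^ 2)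
        + 3 * (\<Sum>i\<in>I. expectation (\<lambda>\<omega>. X i \<omega> ^ 2)) ^ 2"
  using assms
proof (induction I rule: finite_induct)
  case empty
  then show ?case by simp
next
  case (insert i I)
  have IH: "integrable M (\<lambda>\<omega>. (\<Sum>i\<in>I. X i \<omega>) ^ 4)"
    "expectation (\<lambda>\<omega>. \<Sum>i\<in>I. X i \<omega>) = 0"
    "expectation (\<lambda>\<omega>. (\<Sum>i\<in>I. X i \<omega>) ^ 2) = (\<Sum>i\<in>I. expectation (\<lambda>\<omega>. X i \<omega> ^ 2))"
    "expectation (\<lambda>\<omega>. (\<Sum>i\<in>I. X i \<omega>) ^ 3) = (\<Sum>i\<in>I. expectation (\<lambda>\<omega>. X i \<omega> ^ 3))"
    "expectation (\<lambda>\<omega>. (\<Sum>i\<in>I. X i \<omega>) ^ 4) =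
        (\<Sum>i\<in>I. expectation (\<lambda>\<omega>. X i \<omega> ^ 4) - 3 * expectation (\<lambda>\<omega>. X i \<omega> ^ 2) ^ 2)
        + 3 * (\<Sum>i\<in>I. expectation (\<lambda>\<omega>. X i \<omega> ^ 2)) ^ 2"
    using insert.IH[OF indep_vars_subset[OF insert.prems(1)]] insert.prems by auto
  note step = expectation_power_add[OF indep_vars_sum[OF insert.hyps(1,2) insert.prems(1)]
      insert.prems(2)[OF insertI1] insert.prems(3)[OF insertI1] IH(1,2)]
  show ?case
    using step insert.hyps IH by (simp add: power2_eq_square algebra_simps)
qed

text \<open>The raw moments are \<open>fact k * m ^ k\<close>, so binomial inversion makes the
  \<open>n\<close>-th central moment \<open>m ^ n\<close> times the number of derangements of
  \<open>n\<close> objects: 0, 1, 2, 9 for \<open>n\<close> from 1 to 4.\<close>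

lemma (in prob_space) exponential_central_moments:
  assumes "0 < m" "distributed M lborel X (exponential_density (1 / m))"
  shows "integrable M (\<lambda>\<omega>. (X \<omega> - m) ^ 4)"
    and "expectation (\<lambda>\<omega>. X \<omega> - m) = 0"
    and "expectation (\<lambda>\<omega>. (X \<omega> - m) ^ 2) = m ^ 2"
    and "expectation (\<lambda>\<omega>. (X \<omega> - m) ^ 3) = 2 * m ^ 3"
    and "expectation (\<lambda>\<omega>. (X \<omega> - m) ^ 4) = 9 * m ^ 4"
proof -
  have "has_bochner_integral M (\<lambda>\<omega>. X \<omega> ^ k) (fact k * m ^ k)" for k
    \<comment> \<open>The exponential law is the Erlang law with shape parameter 0.\<close>
    using has_bochner_integral_erlang_ith_moment[of "1 / m" X 0 k] assms
    by (simp add: power_divide)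
  then have "has_bochner_integral M (\<lambda>\<omega>. X \<omega> ^ k * c) (fact k * (m ^ k * c))" for k c
    using has_bochner_integral_mult_left[of c M "\<lambda>\<omega>. X \<omega> ^ k" "fact k * m ^ k"]
    by (simp add: mult.assoc)
  then have moment: "has_bochner_integral M (\<lambda>\<omega>. (X \<omega> + (- m)) ^ n)
      (\<Sum>k\<le>n. of_nat (n choose k) * (fact k * m ^ k * (- m) ^ (n - k)))" for n
    unfolding binomial_ring mult.assoc
    by (intro has_bochner_integral_sum has_bochner_integral_mult_right)
  show "integrable M (\<lambda>\<omega>. (X \<omega> - m) ^ 4)"
    using moment[of 4] by (simp add: has_bochner_integral_iff)
  show "expectation (\<lambda>\<omega>. X \<omega> - m) = 0"
    using moment[of 1] by (simp add: has_bochner_integral_iff)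
  show "expectation (\<lambda>\<omega>. (X \<omega> - m) ^ 2) = m ^ 2"
    using moment[of 2] by (simp add: has_bochner_integral_iff eval_nat_numeral)
  show "expectation (\<lambda>\<omega>. (X \<omega> - m) ^ 3) = 2 * m ^ 3"
    using moment[of 3] by (simp add: has_bochner_integral_iff eval_nat_numeral)
  show "expectation (\<lambda>\<omega>. (X \<omega> - m) ^ 4) = 9 * m ^ 4"
    using moment[of 4] by (simp add: has_bochner_integral_iff eval_nat_numeral)
qed

section \<open>Passage from partial sums to the infinite series\<close>

text \<open>By monotone convergence the sum, taken in \<open>ennreal\<close>, has a finite integral,
  hence is finite almost everywhere.\<close>

lemma AE_summable_of_integrals:
  fixes V :: "nat \<Rightarrow> 'a \<Rightarrow> real"
  assumes "\<And>n. integrable M (V n)" "\<And>n. AE \<omega> in M. 0 \<le> V n \<omega>"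
    and "summable (\<lambda>n. integral\<^sup>L M (V n))"
  shows "AE \<omega> in M. summable (\<lambda>n. V n \<omega>)"
proof -
  have [measurable]: "V n \<in> borel_measurable M" for n
    using assms(1) by auto
  have "(\<integral>\<^sup>+\<omega>. (\<Sum>n. ennreal (V n \<omega>)) \<partial>M) = (\<Sum>n. ennreal (integral\<^sup>L M (V n)))"
    by (subst nn_integral_suminf) (auto simp: nn_integral_eq_integral assms(1,2))
  also have "\<dots> = ennreal (\<Sum>n. integral\<^sup>L M (V n))"
    using assms(2,3) by (intro suminf_ennreal_eq summable_sums integral_nonneg_AE)
  finally have "AE \<omega> in M. (\<Sum>n. ennreal (V n \<omega>)) \<noteq> \<infinity>"
    by (intro nn_integral_PInf_AE) auto
  moreover have "AE \<omega> in M. \<forall>n. 0 \<le> V n \<omega>"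
    using assms(2) by (simp add: AE_all_countable)
  ultimately show ?thesis
    by eventually_elim (auto intro: summable_suminf_not_top)
qed

text \<open>The centred sums \<open>S n\<close> are not monotone in \<open>n\<close>, but the
  uncentred ones are. Integrability of the limit is therefore obtained for the uncentred sums first,
  and only then are the centred moments handled by domination.\<close>

lemma (in prob_space) nonneg_series_central_moments:
  fixes V :: "nat \<Rightarrow> 'a \<Rightarrow> real" and c :: "nat \<Rightarrow> real"
  defines "S \<equiv> \<lambda>n \<omega>. \<Sum>i<n. V i \<omega> - c i"
  assumes [measurable]: "\<And>n. V n \<in> borel_measurable M"
    and nonneg: "\<And>n. AE \<omega> in M. 0 \<le> V n \<omega>"
    and summable: "AE \<omega> in M. summable (\<lambda>n. V n \<omega>)"
    and c: "c sums \<mu>" "\<And>n. 0 \<le> c n"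
    and int: "\<And>n. integrable M (\<lambda>\<omega>. S n \<omega> ^ 4)"
    and lim: "\<And>k. k \<le> 4 \<Longrightarrow> (\<lambda>n. expectation (\<lambda>\<omega>. S n \<omega> ^ k)) \<longlonglongrightarrow> L k"
  shows "integrable M (\<lambda>\<omega>. (\<Sum>n. V n \<omega>) ^ 4)"
    and "k \<le> 4 \<Longrightarrow> expectation (\<lambda>\<omega>. ((\<Sum>n. V n \<omega>) - \<mu>) ^ k) = L k"
proof -
  define N where "N \<omega> = (\<Sum>n. V n \<omega>)" for \<omega>
  have [measurable]: "N \<in> borel_measurable M" "\<And>n. S n \<in> borel_measurable M"
    unfolding N_def S_def by measurable
  have S_eq: "(\<Sum>i<n. V i \<omega>) = S n \<omega> + (\<Sum>i<n. c i)" for n \<omega>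
    by (simp add: S_def sum_subtractf)
  have nonneg': "AE \<omega> in M. \<forall>n. 0 \<le> V n \<omega>"
    using nonneg by (simp add: AE_all_countable)
  have c_lim: "(\<lambda>n. \<Sum>i<n. c i) \<longlonglongrightarrow> \<mu>"
    using c(1) by (simp add: sums_def)
  have intS: "integrable M (\<lambda>\<omega>. S n \<omega> ^ k)" if "k \<le> 4" for n k
    by (rule integrable_power_le_4[OF _ int that]) measurable
  \<comment> \<open>Expanding around the centre expresses the uncentred fourth moments through
    quantities whose limits are known from \<open>lim\<close> and \<open>c_lim\<close>, as monotone
    convergence requires.\<close>
  have T: "has_bochner_integral M (\<lambda>\<omega>. (\<Sum>i<n. V i \<omega>) ^ 4)
      (\<Sum>k\<le>4. of_nat (4 choose k) * (expectation (\<lambda>\<omega>. S n \<omega> ^ k) * (\<Sum>i<n. c i) ^ (4 - k)))" for n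
    unfolding S_eq binomial_ring mult.assoc
    by (intro has_bochner_integral_sum has_bochner_integral_mult_right has_bochner_integral_mult_left)
      (auto simp: has_bochner_integral_iff intS)
  show int_N: "integrable M (\<lambda>\<omega>. (\<Sum>n. V n \<omega>) ^ 4)"
    unfolding N_def [symmetric]
  proof (rule integrable_monotone_convergence)
    show "integrable M (\<lambda>\<omega>. (\<Sum>i<n. V i \<omega>) ^ 4)" for n
      using T by (simp add: has_bochner_integral_iff)
    show "AE \<omega> in M. mono (\<lambda>n. (\<Sum>i<n. V i \<omega>) ^ 4)"
      using nonneg' by eventually_elim (auto intro!: monoI power_mono sum_mono2 sum_nonneg)
    show "AE \<omega> in M. (\<lambda>n. (\<Sum>i<n. V i \<omega>) ^ 4) \<longlonglongrightarrow> N \<omega> ^ 4"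
      using summable unfolding N_def
      by eventually_elim (auto intro!: tendsto_power summable_LIMSEQ)
    show "(\<lambda>n. expectation (\<lambda>\<omega>. (\<Sum>i<n. V i \<omega>) ^ 4))
      \<longlonglongrightarrow> (\<Sum>k\<le>4. of_nat (4 choose k) * (L k * \<mu> ^ (4 - k)))"
      unfolding has_bochner_integral_integral_eq[OF T]
      by (intro tendsto_sum tendsto_mult tendsto_const tendsto_power c_lim lim) auto
  qed measurable
  assume k: "k \<le> 4"
  have "(\<lambda>n. expectation (\<lambda>\<omega>. S n \<omega> ^ k)) \<longlonglongrightarrow> expectation (\<lambda>\<omega>. (N \<omega> - \<mu>) ^ k)"
  proof (rule integral_dominated_convergence)
    \<comment> \<open>Almost everywhere \<open>S n\<close> is the difference of a number in
      \<open>[0, N]\<close> and one in \<open>[0, \<mu>]\<close>, so its absolute value is at most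
      \<open>N + \<mu>\<close>. Using
      \<open>(a + b)\<^sup>2 \<le> 2 * (a\<^sup>2 + b\<^sup>2)\<close> twice gives the factor 8; the
      summand 1 covers the exponents below 4.\<close>
    show "integrable M (\<lambda>\<omega>. 1 + 8 * (N \<omega> ^ 4 + \<mu> ^ 4))"
      using int_N by (auto simp: N_def)
    show "AE \<omega> in M. (\<lambda>n. S n \<omega> ^ k) \<longlonglongrightarrow> (N \<omega> - \<mu>) ^ k"
      using summable unfolding N_def S_def sum_subtractf
      by eventually_elim (auto intro!: tendsto_power tendsto_diff summable_LIMSEQ c_lim)
    show "AE \<omega> in M. norm (S n \<omega> ^ k) \<le> 1 + 8 * (N \<omega> ^ 4 + \<mu> ^ 4)" for n
      using summable nonneg'
    proof eventually_elim
      case (elim \<omega>)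
      have "0 \<le> (\<Sum>i<n. V i \<omega>)" "(\<Sum>i<n. V i \<omega>) \<le> N \<omega>"
        using elim unfolding N_def by (auto intro!: sum_nonneg sum_le_suminf)
      moreover have "0 \<le> (\<Sum>i<n. c i)" "(\<Sum>i<n. c i) \<le> \<mu>"
        using c by (auto intro!: sum_nonneg sum_le_suminf simp: sums_iff)
      ultimately have "\<bar>S n \<omega>\<bar> \<le> N \<omega> + \<mu>"
        using S_eq[of \<omega> n] by linarith
      then have "\<bar>S n \<omega>\<bar> ^ 4 \<le> (N \<omega> + \<mu>) ^ 4"
        by (intro power_mono) auto
      also have "\<dots> = ((N \<omega> + \<mu>)\<^sup>2)\<^sup>2" by simp
      also have "(N \<omega> + \<mu>)\<^sup>2 \<le> 2 * (N \<omega> ^ 2 + \<mu> ^ 2)"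
        using sum_squares_bound[of "N \<omega>" \<mu>] by (simp add: power2_sum)
      then have "((N \<omega> + \<mu>)\<^sup>2)\<^sup>2 \<le> (2 * (N \<omega> ^ 2 + \<mu> ^ 2))\<^sup>2"
        by (intro power_mono) simp_all
      also have "\<dots> \<le> 8 * (N \<omega> ^ 4 + \<mu> ^ 4)"
        using sum_squares_bound[of "N \<omega> ^ 2" "\<mu> ^ 2"] by (simp add: power2_sum power_mult_distrib)
      finally show ?case
        using abs_power_le_one_plus_power4[OF k, of "S n \<omega>"] by (simp add: power_abs)
    qed
  qed measurable
  then show "expectation (\<lambda>\<omega>. ((\<Sum>n. V n \<omega>) - \<mu>) ^ k) = L k"
    using lim[OF k] LIMSEQ_unique unfolding N_def by blast
qed

section \<open>Moments of the weighted exponential series\<close>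

theorem corollary1:
  fixes M :: "'a measure" and W :: "nat \<Rightarrow> 'a \<Rightarrow> real" and m :: real
  assumes "prob_space M"
    and "m > 0"
    and "prob_space.indep_vars M (\<lambda>_. borel) W {1..}"
    and "\<And>x. x \<ge> 1 \<Longrightarrow> distributed M lborel (W x) (exponential_density (1 / m))"
  shows "(AE \<omega> in M. summable (\<lambda>n. W (Suc n) \<omega> / real (Suc n) ^ 2))
    \<and> prob_space.expectation M (Nf W) = m * riemann_zeta 2
    \<and> m * riemann_zeta 2 = m * pi ^ 2 / 6
    \<and> prob_space.variance M (Nf W) = m ^ 2 * riemann_zeta 4
    \<and> m ^ 2 * riemann_zeta 4 = m ^ 2 * pi ^ 4 / 90
    \<and> prob_space.expectation M (\<lambda>\<omega>. Nf W \<omega> ^ 2) = 7 * m ^ 2 * pi ^ 4 / 180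
    \<and> prob_space.expectation M (Nf W) / sqrt (prob_space.variance M (Nf W)) = sqrt (5 / 2)
    \<and> skewness M (Nf W) = 4 * sqrt 10 / 7
    \<and> kurtosis M (Nf W) = 57 / 7"
proof -
  interpret prob_space M by fact
  note W = assms(4)
  \<comment> \<open>\<open>X\<close> keeps the index range \<open>{1..}\<close> on which
    independence is assumed, while \<open>V\<close> and \<open>c\<close> are shifted by one to form
    series over all of \<open>nat\<close>; \<open>S_eq\<close> reconciles the two.\<close>
  define X where "X x \<omega> = (W x \<omega> - m) / real x ^ 2" for x \<omega>
  define V where "V n \<omega> = W (Suc n) \<omega> / real (Suc n) ^ 2" for n \<omega>
  define c where "c n = m / real (Suc n) ^ 2" for n
  define \<mu> where "\<mu> = m * pi ^ 2 / 6"
  define S where "S n \<omega> = (\<Sum>i<n. V i \<omega> - c i)" for n \<omega>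

  have zeta2: "(\<lambda>k. 1 / real (Suc k) ^ 2) sums (pi ^ 2 / 6)"
    using inverse_squares_sums by (simp add: add.commute)
  have zeta_values: "riemann_zeta 2 = pi ^ 2 / 6" "riemann_zeta 4 = pi ^ 4 / 90"
    using riemann_zeta_sums[OF zeta2] riemann_zeta_sums[OF sums_inverse_powers(1)] by simp_all

  have W_meas [measurable]: "W (Suc n) \<in> borel_measurable M" for n
    using distributed_measurable[OF W[of "Suc n"]] by simp
  have V_meas [measurable]: "V n \<in> borel_measurable M" for n
    unfolding V_def by measurable
  have V_nonneg: "AE \<omega> in M. 0 \<le> V n \<omega>" for n
  proof -
    have "AE \<omega> in M. 0 \<le> W (Suc n) \<omega>"
      by (subst distributed_AE2[OF W]) (auto simp: exponential_density_def)
    then show ?thesis by eventually_elim (simp add: V_def)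
  qed
  have V_mean: "has_bochner_integral M (V n) (c n)" for n
    using has_bochner_integral_erlang_ith_moment[of "1 / m" "W (Suc n)" 0 1] W[of "Suc n"] \<open>m > 0\<close>
    unfolding V_def c_def by (intro has_bochner_integral_divide_zero) simp
  have c_sums: "c sums \<mu>"
    using sums_mult[OF zeta2, of m] by (simp add: c_def [abs_def] \<mu>_def)
  have summable_V: "AE \<omega> in M. summable (\<lambda>n. V n \<omega>)"
  proof (rule AE_summable_of_integrals)
    show "integrable M (V n)" for n
      using V_mean by (simp add: has_bochner_integral_iff)
    show "summable (\<lambda>n. expectation (V n))"
      using c_sums by (simp add: has_bochner_integral_integral_eq[OF V_mean] sums_summable)
  qed (rule V_nonneg)

  have X_moments: "integrable M (\<lambda>\<omega>. X x \<omega> ^ 4)" "expectation (X x) = 0"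
    "expectation (\<lambda>\<omega>. X x \<omega> ^ 2) = m ^ 2 * (1 / real x ^ 4)"
    "expectation (\<lambda>\<omega>. X x \<omega> ^ 3) = 2 * m ^ 3 * (1 / real x ^ 6)"
    "expectation (\<lambda>\<omega>. X x \<omega> ^ 4) = 9 * m ^ 4 * (1 / real x ^ 8)" if "x \<in> {1..}" for x
    using exponential_central_moments[OF \<open>m > 0\<close> W[of x]] that
    unfolding X_def power_divide by (simp_all flip: power_mult)
  have X_indep: "indep_vars (\<lambda>_. borel) X {1..}"
    unfolding X_def [abs_def] by (rule indep_vars_compose2[OF assms(3)]) simp
  have S_eq: "S n = (\<lambda>\<omega>. \<Sum>x\<in>{1..n}. X x \<omega>)" for n
    by (simp add: fun_eq_iff S_def V_def c_def X_def sum.atLeast1_atMost_eq diff_divide_distrib)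
  have S_moments: "integrable M (\<lambda>\<omega>. S n \<omega> ^ 4)" "expectation (S n) = 0"
    "expectation (\<lambda>\<omega>. S n \<omega> ^ 2) = m ^ 2 * (\<Sum>i<n. 1 / real (Suc i) ^ 4)"
    "expectation (\<lambda>\<omega>. S n \<omega> ^ 3) = 2 * m ^ 3 * (\<Sum>i<n. 1 / real (Suc i) ^ 6)"
    "expectation (\<lambda>\<omega>. S n \<omega> ^ 4) = 6 * m ^ 4 * (\<Sum>i<n. 1 / real (Suc i) ^ 8)
      + 3 * (m ^ 2 * (\<Sum>i<n. 1 / real (Suc i) ^ 4)) ^ 2" for n
  proof -
    have "indep_vars (\<lambda>_. borel) X {1..n}"
      by (rule indep_vars_subset[OF X_indep]) auto
    note * = centered_sum_moments[OF _ this]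
    \<comment> \<open>The fourth cumulant of an exponential variable of mean \<open>m\<close> is
      \<open>(9 - 3) * m ^ 4\<close>.\<close>
    have "9 * m ^ 4 * (1 / real x ^ 8) - 3 * (m ^ 2 * (1 / real x ^ 4)) ^ 2
      = 6 * m ^ 4 * (1 / real x ^ 8)" for x
      by (simp add: power_mult_distrib power_divide flip: power_mult)
    then show "integrable M (\<lambda>\<omega>. S n \<omega> ^ 4)" "expectation (S n) = 0"
      "expectation (\<lambda>\<omega>. S n \<omega> ^ 2) = m ^ 2 * (\<Sum>i<n. 1 / real (Suc i) ^ 4)"
      "expectation (\<lambda>\<omega>. S n \<omega> ^ 3) = 2 * m ^ 3 * (\<Sum>i<n. 1 / real (Suc i) ^ 6)"
      "expectation (\<lambda>\<omega>. S n \<omega> ^ 4) = 6 * m ^ 4 * (\<Sum>i<n. 1 / real (Suc i) ^ 8)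
        + 3 * (m ^ 2 * (\<Sum>i<n. 1 / real (Suc i) ^ 4)) ^ 2"
      using * X_moments
      by (simp_all add: S_eq sum.atLeast1_atMost_eq sum_distrib_left del: of_nat_Suc)
  qed

  \<comment> \<open>The entries from index 2 on are the limits of \<open>S_moments\<close>, with the
    values of zeta at 4, 6 and 8 inserted.\<close>
  define L where "L k = [1, 0, m ^ 2 * (pi ^ 4 / 90), 2 * m ^ 3 * (pi ^ 6 / 945),
    6 * m ^ 4 * (pi ^ 8 / 9450) + 3 * (m ^ 2 * (pi ^ 4 / 90)) ^ 2] ! k" for k
  have L_simps: "L 0 = 1" "L 1 = 0" "L 2 = m ^ 2 * (pi ^ 4 / 90)" "L 3 = 2 * m ^ 3 * (pi ^ 6 / 945)"
    "L 4 = 6 * m ^ 4 * (pi ^ 8 / 9450) + 3 * (m ^ 2 * (pi ^ 4 / 90)) ^ 2"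
    by (simp_all add: L_def)
  have S_lim: "(\<lambda>n. expectation (\<lambda>\<omega>. S n \<omega> ^ k)) \<longlonglongrightarrow> L k" if "k \<le> 4" for k
  proof -
    note lims = sums_inverse_powers[unfolded sums_def]
    have "k \<in> {0, 1, 2, 3, 4}" using that by auto
    then consider "k = 0" | "k = 1" | "k = 2" | "k = 3" | "k = 4" by blast
    then show ?thesis
    proof cases
      case 1
      then show ?thesis by (simp add: L_simps prob_space)
    next
      case 2
      then show ?thesis using L_simps(2) S_moments(2) by simp
    next
      case 3
      show ?thesis unfolding 3 L_simps S_moments by (intro tendsto_intros lims)
    next
      case 4
      show ?thesis unfolding 4 L_simps S_moments by (intro tendsto_intros lims)
    next
      case 5
      show ?thesis unfolding 5 L_simps S_moments by (intro tendsto_intros lims)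
    qed
  qed

  note limit = nonneg_series_central_moments[OF V_meas V_nonneg summable_V c_sums _
      S_moments(1)[unfolded S_def] S_lim[unfolded S_def]]
  have Nf_eq: "Nf W = (\<lambda>\<omega>. \<Sum>n. V n \<omega>)"
    by (simp add: fun_eq_iff Nf_def V_def)
  have Nf_meas [measurable]: "Nf W \<in> borel_measurable M"
    unfolding Nf_eq by measurable
  have c_nonneg: "0 \<le> c n" for n
    using \<open>m > 0\<close> by (simp add: c_def)
  have int4: "integrable M (\<lambda>\<omega>. Nf W \<omega> ^ 4)"
    using limit(1)[OF c_nonneg] by (simp add: Nf_eq)
  have central: "expectation (\<lambda>\<omega>. (Nf W \<omega> - \<mu>) ^ k) = L k" if "k \<le> 4" for k
    using limit(2)[OF c_nonneg _ that] by (simp add: Nf_eq)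
  have int: "integrable M (\<lambda>\<omega>. Nf W \<omega> ^ k)" if "k \<le> 4" for k
    by (rule integrable_power_le_4[OF Nf_meas int4 that])
  \<comment> \<open>Since \<open>L 1 = 0\<close>, the constant \<open>\<mu>\<close> is the mean, so
    the values in \<open>central\<close> are genuine central moments.\<close>
  have mean: "expectation (Nf W) = \<mu>"
    using central[of 1] int[of 1] L_simps(2) by (simp add: prob_space)
  have var: "variance (Nf W) = m ^ 2 * pi ^ 4 / 90"
    using central[of 2] by (simp add: mean L_simps)
  have second: "expectation (\<lambda>\<omega>. Nf W \<omega> ^ 2) = 7 * m ^ 2 * pi ^ 4 / 180"
    using variance_eq[of "Nf W"] int[of 1] int[of 2] var mean
    by (simp add: \<mu>_def power_mult_distrib power_divide flip: power_mult)
  \<comment> \<open>Here \<open>sqrt 90\<close> is written as \<open>3 * sqrt 10\<close>, whose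
    powers are easy to reduce in the quotients below.\<close>
  have sd: "sqrt (variance (Nf W)) = m * pi ^ 2 / (3 * sqrt 10)"
    using \<open>m > 0\<close> unfolding var
    by (intro real_sqrt_unique) (simp_all add: power_mult_distrib power_divide flip: power_mult)
  have third: "expectation (\<lambda>\<omega>. (Nf W \<omega> - \<mu>) ^ 3) = 2 * m ^ 3 * (pi ^ 6 / 945)"
    using central[of 3] by (simp add: L_simps)
  have fourth: "expectation (\<lambda>\<omega>. (Nf W \<omega> - \<mu>) ^ 4)
      = 6 * m ^ 4 * (pi ^ 8 / 9450) + 3 * (m ^ 2 * (pi ^ 4 / 90)) ^ 2"
    using central[of 4] by (simp add: L_simps)
  have snr: "expectation (Nf W) / sqrt (variance (Nf W)) = sqrt (5 / 2)"
  proof -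
    have "sqrt (5 / 2) = sqrt 10 / 2"
      by (intro real_sqrt_unique) (simp_all add: power_divide)
    then show ?thesis
      using \<open>m > 0\<close> unfolding sd by (simp add: mean \<mu>_def field_simps)
  qed
  have skew: "skewness M (Nf W) = 4 * sqrt 10 / 7"
  proof -
    have "sqrt 10 ^ 3 = 10 * sqrt (10::real)"
      by (simp add: power3_eq_cube)
    then show ?thesis
      using \<open>m > 0\<close> unfolding skewness_def std_dev_def sd
      by (simp add: mean third power_divide power_mult_distrib field_simps flip: power_mult)
  qed
  \<comment> \<open>The Gaussian part contributes 3 and the fourth cumulant contributes
    \<open>6 * 90\<^sup>2 / 9450 = 36 / 7\<close>.\<close>
  have kurt: "kurtosis M (Nf W) = 57 / 7"
  proof -
    have "sqrt 10 ^ 4 = (100::real)"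
      using power_mult[of "sqrt (10::real)" 2 2] by simp
    then show ?thesis
      using \<open>m > 0\<close> unfolding kurtosis_def std_dev_def sd
      by (simp add: mean fourth power_divide power_mult_distrib field_simps flip: power_mult)
  qed
  show ?thesis
    using summable_V mean var second snr skew kurt
    unfolding zeta_values V_def \<mu>_def by simp
qed

end
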